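(* Consider the system $\dot x=f(x)+g(x)u+D\varepsilon_T$ with disturbance generated by $\dot\varepsilon_T=S\varepsilon_T$, where: the system is stabilizable, $f(0)=0$, and $f,g$ are locally Lipschitz; $S\in\mathbb{R}^{d\times d}$ is unknown with all eigenvalues on the imaginary axis; and $D\in\mathbb{R}^{n\times d}$ has full column rank. Let $a>0$, $\kappa>0$, let $\Gamma\in\mathbb{R}^{d^2\times d^2}$ be symmetric positive definite, and put $F=D^{+}$. Let $\varepsilon,\bar\varepsilon,\rho,h,l$ be the filtered signals and $Y_i=Y(t_i)$ the recorded data defined in the context. Consider the disturbance observer $$\hat\varepsilon_T=(\hat S+aI_d)\varepsilon+\hat\rho_\Delta,\qquad \dot{\hat\rho}_\Delta=-a\hat\rho_\Delta,\quad \hat\rho_\Delta(0)=\hat\varepsilon_T(0),$$ the auxiliary dynamics $$\hat x=\phi^{*}h+a\,l+\hat{\bar\varepsilon}+\rho,\qquad \dot{\hat\varepsilon}=-a\hat\varepsilon+\hat\varepsilon_T,\qquad \hat{\bar\varepsilon}=D\hat\varepsilon,$$ and, with $\tilde e=x-\hat x$ and $\tilde S=S-\hat S$, the experience-replay adaptive law $$\dot{\hat S}_{vec}=\Gamma\,(\bar\varepsilon^{T}F^{T}\otimes D)^{T}\tilde e+\kappa\,\Gamma\sum_{i=1}^{N}Y_i^{T}Y_i\,\tilde S_{vec}.$$ Assume the system is sufficiently excited over a finite duration: there exist $\omega>0$ and $T>t_0+\Delta t$ such that for all $t>T$, $\lambda_{min}\big(\sum_{i=1}^{N}Y_i^TY_i\big)>\omega$.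 Then $\tilde S$ and the disturbance estimation error $\tilde\varepsilon_T=\varepsilon_T-\hat\varepsilon_T$ converge to zero exponentially fast.
   Context: Setting: $x(t)\in\mathbb{R}^n$ is the measured state, defined for all $t\ge0$; $f:\mathbb{R}^n\to\mathbb{R}^n$ and $g:\mathbb{R}^n\to\mathbb{R}^{n\times m}$ are known, $g(x)$ has full column rank; $u\in\mathbb{R}^m$ is the control input; $\varepsilon_T(t)\in\mathbb{R}^d$ is the unmeasured disturbance. Parametrization: $f(x)=\theta^{*}\xi(x)$ and $g(x)=\psi^{*}\zeta(x)$ with known constant matrices $\theta^{*}\in\mathbb{R}^{n\times p_\theta}$, $\psi^{*}\in\mathbb{R}^{n\times p_\psi}$ and known basis functions $\xi(x)\in\mathbb{R}^{p_\theta}$, $\zeta(x)\in\mathbb{R}^{p_\psi\times m}$. Put $\phi^{*}=[\theta^{*}\ \psi^{*}]$ and $z(x,u)=[\xi(x)^T\ \ u^T\zeta(x)^T]^T$, so $\dot x=\phi^{*}z(x,u)+D\varepsilon_T$. Filtered signals: $\dot h=-ah+z(x,u)$, $h(0)=0$; $\dot l=-al+x$, $l(0)=0$; $\dot\rho=-a\rho$, $\rho(0)=x(0)$; $\dot\varepsilon=-a\varepsilon+\varepsilon_T$, $\varepsilon(0)=0$; $\bar\varepsilon=D\varepsilon$. These satisfy $x=\phi^{*}h+a\,l+\bar\varepsilon+\rho$, so $\bar\varepsilon$ and $\varepsilon=D^{+}\bar\varepsilon$ are available from the measured state. Recorded data (history stack): fix $t_0\ge0$ and a window size $\Delta t>0$.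 Let $Y(t)=0$ for $t\in[t_0,t_0+\Delta t]$ and $Y(t)=\int_{t-\Delta t}^{t}(\bar\varepsilon(\tau)^TF^T\otimes D)\,d\tau$ for $t>t_0+\Delta t$. At time $t$ the stack consists of finitely many recorded times $t_i\in[t_0,t]$, $i=1,\dots,N$ (piecewise constant in $t$), and $Y_i=Y(t_i)$; the replay sum is zero for times before any data have been recorded. Notation: $D^{+}=(D^TD)^{-1}D^T$ is the pseudoinverse; $\otimes$ is the Kronecker product; $\lambda_{min}$ is the minimum eigenvalue; $A_{vec}$ is the vector obtained by stacking the columns of $A$, so that $(\bar\varepsilon^TF^T\otimes D)A_{vec}=DAF\bar\varepsilon$ for $A\in\mathbb{R}^{d\times d}$; $\hat S(t)\in\mathbb{R}^{d\times d}$ is the estimate of $S$. Initial values $\hat S(0)$, $\hat\varepsilon(0)$, $\hat\varepsilon_T(0)$ are arbitrary. "Exponentially fast" means bounded in norm by $Ce^{-ct}$ for all large $t$, for some constants $C,c>0$. *)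

theory Defs
  imports "HOL-Analysis.Analysis"
begin

text \<open>Signals may satisfy their differential equation piecewise: \<open>w\<close> is continuous, and
  \<open>w' = w_dot\<close> may fail on a locally finite set of times (jumps of the control input or of the
  recorded data). Where \<open>w_dot\<close> is continuous this amounts to a classical solution.\<close>

definition solution_on :: "real set \<Rightarrow> (real \<Rightarrow> 'a::real_normed_vector) \<Rightarrow> (real \<Rightarrow> 'a) \<Rightarrow> bool" where
  "solution_on I w w_dot \<longleftrightarrow>
     continuous_on I w \<and>
     (\<exists>J. (\<forall>a b. finite (J \<inter> {a..b})) \<and>
          (\<forall>t\<in>I - J. (w has_vector_derivative w_dot t) (at t within I)))"

definition exponentially_convergent :: "(real \<Rightarrow> 'a::real_normed_vector) \<Rightarrow> bool" where
  "exponentially_convergent w \<longleftrightarrow>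
     (\<exists>C>0. \<exists>c>0. \<forall>\<^sub>F t in at_top. norm (w t) \<le> C * exp (- c * t))"

text \<open>Stability is required of solutions on bounded intervals as well, so it also excludes
  finite escape of solutions starting near the origin.\<close>

definition asymptotically_stable_origin :: "('a::real_normed_vector \<Rightarrow> 'a) \<Rightarrow> bool" where
  "asymptotically_stable_origin V \<longleftrightarrow>
     (\<forall>e>0. \<exists>\<delta>>0. \<forall>b\<ge>0. \<forall>x. solution_on {0..b} x (\<lambda>t. V (x t)) \<longrightarrow> norm (x 0) < \<delta> \<longrightarrow>
        (\<forall>t\<in>{0..b}. norm (x t) < e)) \<and>
     (\<exists>\<delta>>0. \<forall>x. solution_on {0..} x (\<lambda>t. V (x t)) \<longrightarrow> norm (x 0) < \<delta> \<longrightarrow>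
        (x \<longlongrightarrow> 0) at_top)"

text \<open>Stabilizability of the undisturbed system by continuous state feedback. Only a neighbourhood
  of the origin matters, so continuity of the feedback on the whole space is no restriction.\<close>

definition stabilizable :: "(real^'n \<Rightarrow> real^'n) \<Rightarrow> (real^'n \<Rightarrow> real^'m^'n) \<Rightarrow> bool" where
  "stabilizable f g \<longleftrightarrow>
     (\<exists>k. continuous_on UNIV k \<and> asymptotically_stable_origin (\<lambda>x. f x + g x *v k x))"

definition eigenvalue :: "'a::field^'n^'n \<Rightarrow> 'a \<Rightarrow> bool" where
  "eigenvalue A \<mu> \<longleftrightarrow> (\<exists>v. v \<noteq> 0 \<and> A *v v = \<mu> *s v)"

definition complex_matrix :: "real^'n^'m \<Rightarrow> complex^'n^'m" where
  "complex_matrix A = (\<chi> i j. complex_of_real (A $ i $ j))"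

text \<open>Meant for symmetric matrices, whose real eigenvalues are all their eigenvalues.\<close>

definition lambda_min :: "real^'n^'n \<Rightarrow> real" where
  "lambda_min A = Min {\<mu>. eigenvalue A \<mu>}"

definition symmetric_positive_definite :: "real^'n^'n \<Rightarrow> bool" where
  "symmetric_positive_definite A \<longleftrightarrow> transpose A = A \<and> (\<forall>v. v \<noteq> 0 \<longrightarrow> v \<bullet> (A *v v) > 0)"

definition pseudoinverse :: "real^'d^'n \<Rightarrow> real^'n^'d" where
  "pseudoinverse D = matrix_inv (transpose D ** D) ** transpose D"

definition hconcat :: "real^'p^'n \<Rightarrow> real^'q^'n \<Rightarrow> real^('p + 'q)^'n" where
  "hconcat A B = (\<chi> i j. case j of Inl k \<Rightarrow> A $ i $ k | Inr k \<Rightarrow> B $ i $ k)"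

definition vconcat :: "real^'p \<Rightarrow> real^'q \<Rightarrow> real^('p + 'q)" where
  "vconcat v w = (\<chi> j. case j of Inl k \<Rightarrow> v $ k | Inr k \<Rightarrow> w $ k)"

definition kronecker :: "real^'c^'r \<Rightarrow> real^'e^'s \<Rightarrow> real^('c \<times> 'e)^('r \<times> 's)" where
  "kronecker A B = (\<chi> p q. A $ fst p $ fst q * B $ snd p $ snd q)"

text \<open>Stacked columns: position \<open>(j, i)\<close> holds row \<open>i\<close> of column \<open>j\<close>, matching the block order of
  \<^const>\<open>kronecker\<close>.\<close>

definition stack_columns :: "real^'c^'r \<Rightarrow> real^('c \<times> 'r)" where
  "stack_columns A = (\<chi> p. A $ snd p $ fst p)"

text \<open>The regressor \<open>w\<^sup>T F\<^sup>T \<otimes> D\<close>; its row index type \<open>1 \<times> 'n\<close> is identified with \<open>'n\<close>.\<close>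

definition regressor :: "real^'n^'d \<Rightarrow> real^'d^'n \<Rightarrow> real^'n \<Rightarrow> real^('d \<times> 'd)^'n" where
  "regressor F D w =
     (\<chi> i. kronecker ((rowvector w :: real^'n^1) ** transpose F) D $ (1, i))"

lemma regressor_stack_columns:
  fixes F :: "real^'n^'d" and D :: "real^'d^'n"
  shows "regressor F D w *v stack_columns A = D *v (A *v (F *v w))"
proof -
  have F: "((rowvector w :: real^'n^1) ** transpose F) $ 1 $ j = (F *v w) $ j" for j
    by (simp add: rowvector_def transpose_def matrix_matrix_mult_def matrix_vector_mult_def mult.commute)
  have R: "regressor F D w $ i $ p = (F *v w) $ fst p * D $ i $ snd p" for i p
    by (simp add: regressor_def kronecker_def F)
  have "(regressor F D w *v stack_columns A) $ i =
      (\<Sum>p\<in>UNIV \<times> UNIV. (F *v w) $ fst p * D $ i $ snd p * A $ snd p $ fst p)" for i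
    by (simp add: matrix_vector_mult_def[of "regressor F D w"] R stack_columns_def)
  also have "\<dots> i = (\<Sum>j\<in>UNIV. \<Sum>k\<in>UNIV. (F *v w) $ j * D $ i $ k * A $ k $ j)" for i
    by (simp add: sum.cartesian_product case_prod_beta)
  also have "\<dots> i = (\<Sum>k\<in>UNIV. \<Sum>j\<in>UNIV. (F *v w) $ j * D $ i $ k * A $ k $ j)" for i
    by (rule sum.swap)
  also have "\<dots> i = (D *v (A *v (F *v w))) $ i" for i
    by (simp add: matrix_vector_mult_def[of D] matrix_vector_mult_def[of A]
        sum_distrib_left mult_ac)
  finally show ?thesis
    by (simp add: vec_eq_iff)
qed

definition windowed_data ::
  "real^'n^'d \<Rightarrow> real^'d^'n \<Rightarrow> (real \<Rightarrow> real^'n) \<Rightarrow> real \<Rightarrow> real \<Rightarrow> real \<Rightarrow> real^('d \<times> 'd)^'n" where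
  "windowed_data F D w t0 \<Delta>t t =
     (if t \<le> t0 + \<Delta>t then 0 else integral {t - \<Delta>t..t} (\<lambda>\<tau>. regressor F D (w \<tau>)))"

text \<open>The history stack at time \<open>t\<close> is the finite list \<open>stack t\<close> of recorded times, as a
  piecewise constant function of \<open>t\<close>; it is necessarily empty for \<open>t < t0\<close>.\<close>

definition history_stack :: "real \<Rightarrow> (real \<Rightarrow> real list) \<Rightarrow> bool" where
  "history_stack t0 stack \<longleftrightarrow>
     (\<forall>t\<ge>0. set (stack t) \<subseteq> {t0..t}) \<and>
     (\<exists>J. (\<forall>a b. finite (J \<inter> {a..b})) \<and>
          (\<forall>s t. 0 \<le> s \<longrightarrow> s \<le> t \<longrightarrow> {s..t} \<inter> J = {} \<longrightarrow> stack s = stack t))"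

definition replay_sum :: "(real \<Rightarrow> real^'k^'n) \<Rightarrow> real list \<Rightarrow> real^'k^'k" where
  "replay_sum Y ts = (\<Sum>\<tau>\<leftarrow>ts. transpose (Y \<tau>) ** Y \<tau>)"

end

theory Submission
  imports Defs "HOL-Computational_Algebra.Fundamental_Theorem_Algebra"
begin

text \<open>The identity \<open>x = \<phi> h + a l + D \<epsilon> + \<rho>\<close> turns the output error into \<open>e = D (\<epsilon> - \<epsilon>_hat)\<close>, and
  \<open>\<epsilon>\<^sub>T - (S + a I) \<epsilon>\<close> decays like \<open>exp (- a t)\<close>, so \<open>\<epsilon>\<^sub>T - \<epsilon>\<^sub>T_hat = S_err \<epsilon>\<close> up to such a term. Along
  \<open>V = \<bar>e\<bar>\<^sup>2 + s \<bullet> \<Gamma>\<^sup>-\<^sup>1 s\<close>, with \<open>s\<close> the stacked parameter error, the regressor terms cancel, the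
  replay term supplies negative definiteness in \<open>s\<close> once the excitation condition holds, and hence
  \<open>V' \<le> - p V + K exp (- 2 a t)\<close>. Since \<open>S\<close> may have Jordan blocks, \<open>\<epsilon>\<close> need not be bounded, but it
  grows more slowly than every exponential, so \<open>S_err \<epsilon>\<close> still decays exponentially.\<close>

subsection \<open>Piecewise solutions and scalar comparison\<close>

lemma solution_on_subset: "solution_on I w w' \<Longrightarrow> I' \<subseteq> I \<Longrightarrow> solution_on I' w w'"
  unfolding solution_on_def
  by (elim conjE exE, intro conjI exI[where x=J for J], erule (1) continuous_on_subset, assumption)
    (blast intro:  has_vector_derivative_within_subset)

lemma solution_on_cong:
  assumes "solution_on I w w'" "\<And>t. t \<in> I \<Longrightarrow> v t = w t" "\<And>t. t \<in> I \<Longrightarrow> v' t = w' t"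
  shows "solution_on I v v'"
proof -
  obtain J where J: "\<And>a b. finite (J \<inter> {a..b})" "continuous_on I w"
    "\<And>t. t \<in> I - J \<Longrightarrow> (w has_vector_derivative w' t) (at t within I)"
    using assms(1) unfolding solution_on_def by blast
  have "(v has_vector_derivative v' t) (at t within I)" if "t \<in> I - J" for t
    using has_vector_derivative_transform[of t I v w] J(3)[OF that] assms(2,3) that by auto
  moreover have "continuous_on I v"
    using J(2) assms(2) by (simp cong: continuous_on_cong)
  ultimately show ?thesis
    unfolding solution_on_def using J(1) by blast
qed

lemma finite_Un_Int: "finite (J \<inter> A) \<Longrightarrow> finite (K \<inter> A) \<Longrightarrow> finite ((J \<union> K) \<inter> A)"
  by (simp add: Int_Un_distrib2)

lemma solution_on_bilinear:
  assumes "bounded_bilinear B" "solution_on I v v'" "solution_on I w w'"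
  shows "solution_on I (\<lambda>t. B (v t) (w t)) (\<lambda>t. B (v t) (w' t) + B (v' t) (w t))"
proof -
  obtain J where J: "\<And>a b. finite (J \<inter> {a..b})" "continuous_on I v"
    "\<And>t. t \<in> I - J \<Longrightarrow> (v has_vector_derivative v' t) (at t within I)"
    using assms(2) unfolding solution_on_def by blast
  obtain K where K: "\<And>a b. finite (K \<inter> {a..b})" "continuous_on I w"
    "\<And>t. t \<in> I - K \<Longrightarrow> (w has_vector_derivative w' t) (at t within I)"
    using assms(3) unfolding solution_on_def by blast
  show ?thesis
    \<comment> \<open>The product rule holds off \<open>J \<union> K\<close>, which is still locally
      finite.\<close>
    unfolding solution_on_def
    using J K
    by (intro conjI exI[of _ "J \<union> K"] allI ballI finite_Un_Int
        bounded_bilinear.continuous_on[OF assms(1)]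
        bounded_bilinear.has_vector_derivative[OF assms(1)]) auto
qed

lemma solution_on_add:
  assumes "solution_on I v v'" "solution_on I w w'"
  shows "solution_on I (\<lambda>t. v t + w t) (\<lambda>t. v' t + w' t)"
proof -
  obtain J where J: "\<And>a b. finite (J \<inter> {a..b})" "continuous_on I v"
    "\<And>t. t \<in> I - J \<Longrightarrow> (v has_vector_derivative v' t) (at t within I)"
    using assms(1) unfolding solution_on_def by blast
  obtain K where K: "\<And>a b. finite (K \<inter> {a..b})" "continuous_on I w"
    "\<And>t. t \<in> I - K \<Longrightarrow> (w has_vector_derivative w' t) (at t within I)"
    using assms(2) unfolding solution_on_def by blast
  show ?thesis
    unfolding solution_on_def
    using J K
    by (intro conjI exI[of _ "J \<union> K"] allI ballI finite_Un_Int
        continuous_on_add has_vector_derivative_add) auto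
qed

lemma solution_on_linear:
  assumes "bounded_linear L" "solution_on I w w'"
  shows "solution_on I (\<lambda>t. L (w t)) (\<lambda>t. L (w' t))"
proof -
  obtain K where K: "\<And>a b. finite (K \<inter> {a..b})" "continuous_on I w"
    "\<And>t. t \<in> I - K \<Longrightarrow> (w has_vector_derivative w' t) (at t within I)"
    using assms(2) unfolding solution_on_def by blast
  show ?thesis
    unfolding solution_on_def
    using K
    by (intro conjI exI[of _ K] allI ballI bounded_linear.continuous_on[OF assms(1)]
        bounded_linear.has_vector_derivative[OF assms(1)]) auto
qed

lemma solution_on_diff:
  assumes "solution_on I v v'" "solution_on I w w'"
  shows "solution_on I (\<lambda>t. v t - w t) (\<lambda>t. v' t - w' t)"
  using solution_on_add[OF assms(1) solution_on_linear[OF bounded_linear_minus[OF bounded_linear_ident] assms(2)]]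
  by simp

lemma solution_on_const: "solution_on I (\<lambda>t. c) (\<lambda>t. 0)"
  unfolding solution_on_def by (auto intro!: exI[of _ "{}"])

lemma solution_on_classical:
  assumes "\<And>t. (w has_vector_derivative w' t) (at t)" shows "solution_on I w w'"
  unfolding solution_on_def
proof (intro conjI exI[of _ "{}"] ballI allI)
  show "continuous_on I w"
    using assms by (meson continuous_at_imp_continuous_on has_vector_derivative_continuous)
  show "(w has_vector_derivative w' t) (at t within I)" for t
   by (rule has_vector_derivative_at_within) (rule assms)
qed simp

text \<open>Only finitely many exceptional times lie in a bounded interval, so the fundamental
  theorem of calculus still writes the increment of the continuous \<open>w\<close> as an integral
  of a nonpositive function.\<close>

lemma solution_on_nonincreasing:
  fixes w :: "real \<Rightarrow> real"
  assumes sol: "solution_on {T..} w w'" and le: "\<And>t. t > T \<Longrightarrow> w' t \<le> 0" and "t \<ge> T"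
  shows "w t \<le> w T"
proof -
  obtain J where J: "\<And>a b. finite (J \<inter> {a..b})" and cont: "continuous_on {T..} w"
    and der: "\<And>t. t \<in> {T..} - J \<Longrightarrow> (w has_vector_derivative w' t) (at t within {T..})"
    using sol unfolding solution_on_def by blast
  \<comment> \<open>Truncating by \<open>min\<close> changes nothing at times after
    \<open>T\<close>, but makes the integrand nonpositive at \<open>T\<close> itself, where no sign
    is assumed.\<close>
  have "(w has_vector_derivative min (w' r) 0) (at r)" if "r \<in> {T<..<t} - J \<inter> {T..t}" for r
  proof -
    have "(w has_vector_derivative w' r) (at r within {T..})"
      using der[of r] that by auto
    moreover have "at r within {T..} = at r"
      using that by (intro at_within_interior) simp
    ultimately show ?thesis
      using le[of r] that by (simp add: min_def)
  qed
  then have "((\<lambda>r. min (w' r) 0) has_integral w t - w T) {T..t}"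
    using J \<open>t \<ge> T\<close> cont
    by (intro fundamental_theorem_of_calculus_interior_strong[where S = "J \<inter> {T..t}"])
       (auto intro: continuous_on_subset)
  then have "w t - w T \<le> 0"
    by (rule has_integral_le[where g = "\<lambda>_. 0" and j = 0]) auto
  then show ?thesis by simp
qed

text \<open>An integrating factor reduces the inequality to monotonicity. The condition
  \<open>b \<noteq> p\<close> excludes resonance, which would bring in a factor \<open>t\<close>;
  \<open>q\<close> is any common upper bound for the two exponents.\<close>

lemma solution_on_comparison:
  fixes w :: "real \<Rightarrow> real"
  assumes sol: "solution_on {T..} w w'" and "T \<ge> 0"
    and le: "\<And>t. t > T \<Longrightarrow> w' t \<le> p * w t + K * exp (b * t)"
    and "b \<noteq> p" "p \<le> q" "b \<le> q"
  obtains C where "C > 0" "\<And>t. t \<ge> T \<Longrightarrow> w t \<le> C * exp (q * t)"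
proof -
  \<comment> \<open>\<open>L * exp (b * t)\<close> is a particular solution of the comparison
    equation \<open>w' = p * w + K * exp (b * t)\<close>; \<open>v\<close> is the deviation of
    \<open>w\<close> from it, times the integrating factor.\<close>
  define L where "L = K / (b - p)"
  define v where "v t = exp (- p * t) * w t - L * exp ((b - p) * t)" for t
  have LK: "L * (b - p) = K"
    using \<open>b \<noteq> p\<close> by (simp add: L_def)
  define m where "m t = exp (- p * t) * w' t + (- p * exp (- p * t)) * w t" for t
  have ex: "solution_on {T..} (\<lambda>t. exp (c * t)) (\<lambda>t. c * exp (c * t))" for c
    by (rule solution_on_classical)
       (auto intro!: derivative_eq_intros simp flip: has_real_derivative_iff_has_vector_derivative)
  have v: "solution_on {T..} v (\<lambda>t. m t - L * ((b - p) * exp ((b - p) * t)))"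
    unfolding v_def m_def
    by (intro solution_on_diff solution_on_bilinear[OF bounded_bilinear_mult]
        solution_on_linear[OF bounded_linear_mult_right] ex sol)
  have "m t - L * ((b - p) * exp ((b - p) * t)) \<le> 0" if "t > T" for t
  proof -
    have e2: "exp ((b - p) * t) = exp (- p * t) * exp (b * t)"
      by (simp add: exp_add[symmetric] algebra_simps)
    have "m t = exp (- p * t) * (w' t - p * w t)"
      by (simp add: m_def algebra_simps)
    also have "\<dots> \<le> exp (- p * t) * (K * exp (b * t))"
      using le[OF that] by (intro mult_left_mono) auto
    also have "\<dots> = L * ((b - p) * exp ((b - p) * t))"
      unfolding e2 by (simp add: LK[symmetric])
    finally show ?thesis by simp
  qed
  then have vT: "v t \<le> v T" if "t \<ge> T" for t
    using solution_on_nonincreasing[OF v _ that] by blast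
  \<comment> \<open>Neither \<open>v T\<close> nor \<open>L\<close> has a known sign, hence the
    absolute values; the added 1 makes the constant strictly positive.\<close>
  have bound: "w t \<le> (\<bar>v T\<bar> + \<bar>L\<bar> + 1) * exp (q * t)" if "t \<ge> T" for t
  proof -
    have e: "exp (- p * t) * exp (p * t) = 1" "exp ((b - p) * t) * exp (p * t) = exp (b * t)"
      by (simp_all add: exp_add[symmetric] algebra_simps)
    have "v t * exp (p * t) =
        w t * (exp (- p * t) * exp (p * t)) - L * (exp ((b - p) * t) * exp (p * t))"
      by (simp add: v_def algebra_simps)
    then have "w t = v t * exp (p * t) + L * exp (b * t)"
      unfolding e by simp
    also have "\<dots> \<le> \<bar>v T\<bar> * exp (p * t) + \<bar>L\<bar> * exp (b * t)"
      using vT[OF that] by (intro add_mono mult_right_mono) auto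
    also have "\<dots> \<le> \<bar>v T\<bar> * exp (q * t) + \<bar>L\<bar> * exp (q * t)"
      using that assms by (intro add_mono mult_left_mono) (auto intro!: mult_right_mono)
    also have "\<dots> = (\<bar>v T\<bar> + \<bar>L\<bar>) * exp (q * t)"
      by (simp add: distrib_right)
    also have "\<dots> \<le> (\<bar>v T\<bar> + \<bar>L\<bar> + 1) * exp (q * t)"
      by (rule mult_right_mono) auto
    finally show ?thesis .
  qed
  show ?thesis
    by (rule that[of "\<bar>v T\<bar> + \<bar>L\<bar> + 1"]) (use bound in auto)
qed

section \<open>Growth and decay estimates from the squared norm\<close>

lemma solution_on_norm_square:
  fixes w :: "real \<Rightarrow> 'a::real_inner"
  assumes "solution_on I w w'"
  shows "solution_on I (\<lambda>t. (norm (w t))\<^sup>2) (\<lambda>t. 2 * (w t \<bullet> w' t))"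
  using solution_on_bilinear[OF bounded_bilinear_inner assms assms]
  by (simp add: power2_norm_eq_inner inner_commute)

lemma exp_bound_from_square:
  fixes C :: real
  assumes "(norm y)\<^sup>2 \<le> C * exp (2 * r * t)" "C > 0"
  shows "norm y \<le> sqrt C * exp (r * t)"
proof (rule power2_le_imp_le)
  show "(norm y)\<^sup>2 \<le> (sqrt C * exp (r * t))\<^sup>2"
    using assms by (simp add: power_mult_distrib exp_double[symmetric] mult.assoc)
qed (use assms in simp)

text \<open>Forcing of exponential rate \<open>r\<close> costs nothing in the exponent: splitting
  the cross term by Young's inequality with weight \<open>r\<close> leaves growth rate
  \<open>r\<close> for the squared norm, below the rate \<open>2 * r\<close> of its forcing.\<close>

lemma dissipative_forced_bound:
  fixes w y :: "real \<Rightarrow> 'a::real_inner"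
  assumes sol: "solution_on {0..} w w'" and "r > 0"
    and dis: "\<And>t. t > 0 \<Longrightarrow> w t \<bullet> (w' t - y t) \<le> 0"
    and y: "\<And>t. t \<ge> 0 \<Longrightarrow> norm (y t) \<le> C * exp (r * t)"
  obtains K where "K > 0" "\<And>t. t \<ge> 0 \<Longrightarrow> norm (w t) \<le> K * exp (r * t)"
proof -
  have "2 * (w t \<bullet> w' t) \<le> r * (norm (w t))\<^sup>2 + C\<^sup>2 / r * exp ((2 * r) * t)" if "t > 0" for t
  proof -
    have "2 * (w t \<bullet> w' t) \<le> 2 * (w t \<bullet> y t)"
      using dis[OF that] by (simp add: inner_diff_right)
    also have "\<dots> \<le> 2 * (norm (w t) * norm (y t))"
      using norm_cauchy_schwarz[of "w t" "y t"] by simp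
    also have "\<dots> \<le> r * (norm (w t))\<^sup>2 + (norm (y t))\<^sup>2 / r"
    proof -
      have "0 \<le> (r * norm (w t) - norm (y t))\<^sup>2 / r"
        using \<open>r > 0\<close> by simp
      also have "\<dots> = r * (norm (w t))\<^sup>2 + (norm (y t))\<^sup>2 / r - 2 * (norm (w t) * norm (y t))"
        using \<open>r > 0\<close> by (simp add: field_simps power2_eq_square)
      finally show ?thesis by simp
    qed
    also have "(norm (y t))\<^sup>2 \<le> (C * exp (r * t))\<^sup>2"
      using y[of t] that by (intro power_mono) auto
    also have "(C * exp (r * t))\<^sup>2 = C\<^sup>2 * exp (2 * r * t)"
      by (simp add: power_mult_distrib exp_double[symmetric] mult.assoc)
    finally show ?thesis using \<open>r > 0\<close> by (simp add: divide_right_mono)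
  qed
  from solution_on_comparison[OF solution_on_norm_square[OF sol] _ this, of "2 * r"]
  obtain K where "K > 0" "\<And>t. t \<ge> 0 \<Longrightarrow> (norm (w t))\<^sup>2 \<le> K * exp (2 * r * t)"
    using \<open>r > 0\<close> by auto
  then show ?thesis
    by (intro that[of "sqrt K"]) (auto intro: exp_bound_from_square)
qed

lemma exponential_decay_bound:
  fixes w :: "real \<Rightarrow> 'a::real_inner"
  assumes sol: "solution_on {0..} w (\<lambda>t. - a *\<^sub>R w t)" and "a > 0"
  obtains C where "C > 0" "\<And>t. t \<ge> 0 \<Longrightarrow> norm (w t) \<le> C * exp (- a * t)"
proof -
  obtain C where "C > 0" "\<And>t. t \<ge> 0 \<Longrightarrow> (norm (w t))\<^sup>2 \<le> C * exp (- 2 * a * t)"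
    \<comment> \<open>With \<open>K = 0\<close> the exponent \<open>b\<close> is fictitious;
      \<open>- 3 * a\<close> merely differs from \<open>p\<close> and lies below
      \<open>q\<close>.\<close>
    using solution_on_comparison[OF solution_on_norm_square[OF sol],
        where p = "- 2 * a" and K = 0 and b = "- 3 * a" and q = "- 2 * a"] \<open>a > 0\<close>
    by (auto simp: power2_norm_eq_inner)
  then show ?thesis
    using exp_bound_from_square[of _ C "- a"] by (intro that[of "sqrt C"]) auto
qed

lemma zero_solution_unique:
  fixes w :: "real \<Rightarrow> 'a::real_inner"
  assumes sol: "solution_on {0..} w (\<lambda>t. - a *\<^sub>R w t)" and "a > 0" "w 0 = 0" "t \<ge> 0"
  shows "w t = 0"
proof -
  have "(norm (w t))\<^sup>2 \<le> (norm (w 0))\<^sup>2"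
    by (rule solution_on_nonincreasing[OF solution_on_norm_square[OF sol]])
       (use assms in auto)
  then show ?thesis using \<open>w 0 = 0\<close> by simp
qed

subsection \<open>Symmetric matrices and pseudoinverses\<close>

lemma inner_symmetric_matrix:
  fixes A :: "real^'n^'n"
  assumes "transpose A = A"
  shows "v \<bullet> (A *v w) = (A *v v) \<bullet> w"
  using assms by (metis dot_lmul_matrix vector_transpose_matrix)

text \<open>A minimizer of the quadratic form over the compact unit sphere is an eigenvector, by
  first-order optimality.\<close>

lemma rayleigh_minimum_eigenvalue:
  fixes A :: "real^'n^'n"
  assumes sym: "transpose A = A"
  obtains \<mu> where "eigenvalue A \<mu>" "\<And>v. \<mu> * (v \<bullet> v) \<le> v \<bullet> (A *v v)"
proof -
  have "continuous_on (sphere 0 1) (\<lambda>v. v \<bullet> (A *v v))"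
    by (intro continuous_intros linear_continuous_on matrix_vector_mul_bounded_linear)
  moreover have "axis undefined 1 \<in> sphere (0 :: real^'n) 1"
    by simp
  ultimately obtain e where e: "norm e = 1"
    and min: "\<And>v. norm v = 1 \<Longrightarrow> e \<bullet> (A *v e) \<le> v \<bullet> (A *v v)"
    using continuous_attains_inf[OF compact_sphere, of "0 :: real^'n" 1 "\<lambda>v. v \<bullet> (A *v v)"] by auto
  define \<mu> where "\<mu> = e \<bullet> (A *v e)"
  have bound: "\<mu> * (v \<bullet> v) \<le> v \<bullet> (A *v v)" for v
  proof (cases "v = 0")
    case False
    have "\<mu> \<le> (v /\<^sub>R norm v) \<bullet> (A *v (v /\<^sub>R norm v))"
      unfolding \<mu>_def by (rule min) (use False in simp)
    also have "\<dots> = (v \<bullet> (A *v v)) / (norm v)\<^sup>2"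
      by (simp add: matrix_vector_mult_scaleR power2_eq_square divide_inverse mult_ac)
    finally show ?thesis
      using False by (simp add: field_simps power2_norm_eq_inner)
  qed simp
  define r where "r = A *v e - \<mu> *\<^sub>R e"
  have ee: "e \<bullet> e = 1"
    using e by (simp add: norm_eq_1)
  have "r = 0"
  proof (rule ccontr)
    assume "r \<noteq> 0"
    \<comment> \<open>Perturbing the minimizer by \<open>- s r\<close> changes \<open>v \<bullet> A v - \<mu> \<bar>v\<bar>\<^sup>2\<close> by
      \<open>- 2 s \<bar>r\<bar>\<^sup>2 + O(s\<^sup>2)\<close>.\<close>
    define k where "k = r \<bullet> (A *v r) - \<mu> * (r \<bullet> r)"
    have "0 \<le> k"
      using bound[of r] by (simp add: k_def)
    have rr: "r \<bullet> r > 0"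
      using \<open>r \<noteq> 0\<close> by simp
    have er: "r \<bullet> (A *v e) - \<mu> * (r \<bullet> e) = r \<bullet> r"
      by (simp add: r_def inner_diff_right algebra_simps)
    have eAr: "e \<bullet> (A *v r) = r \<bullet> (A *v e)"
      using inner_symmetric_matrix[OF sym, of e r] by (simp add: inner_commute)
    have key: "2 * s * (r \<bullet> r) \<le> s\<^sup>2 * k" for s
    proof -
      have "\<mu> * ((e - s *\<^sub>R r) \<bullet> (e - s *\<^sub>R r)) \<le> (e - s *\<^sub>R r) \<bullet> (A *v (e - s *\<^sub>R r))"
        by (rule bound)
      also have "(e - s *\<^sub>R r) \<bullet> (A *v (e - s *\<^sub>R r)) =
          \<mu> - 2 * s * (r \<bullet> (A *v e)) + s\<^sup>2 * (r \<bullet> (A *v r))"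
        by (simp add: matrix_vector_mult_diff_distrib matrix_vector_mult_scaleR inner_diff_left
            inner_diff_right eAr \<mu>_def algebra_simps power2_eq_square)
      also have "(e - s *\<^sub>R r) \<bullet> (e - s *\<^sub>R r) = 1 - 2 * s * (r \<bullet> e) + s\<^sup>2 * (r \<bullet> r)"
        by (simp add: inner_diff_left inner_diff_right ee inner_commute[of e r]
            algebra_simps power2_eq_square)
      finally show ?thesis
        unfolding k_def er[symmetric] by (simp add: algebra_simps)
    qed
    \<comment> \<open>Small enough that the quadratic term cannot offset the linear one;
      \<open>k + 1\<close> instead of \<open>k\<close> avoids a zero denominator.\<close>
    define s where "s = (r \<bullet> r) / (k + 1)"
    have "s > 0"
      using rr \<open>0 \<le> k\<close> by (simp add: s_def)
    then have "2 * (r \<bullet> r) \<le> s * k"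
      using key[of s] by (simp add: power2_eq_square mult.assoc)
    also have "\<dots> \<le> s * (k + 1)"
      using \<open>s > 0\<close> by simp
    also have "\<dots> = r \<bullet> r"
      using \<open>0 \<le> k\<close> by (simp add: s_def)
    finally show False using rr by simp
  qed
  then have "eigenvalue A \<mu>"
    unfolding eigenvalue_def r_def using e
    by (intro exI[of _ e]) (auto simp: scalar_mult_eq_scaleR)
  then show ?thesis using bound that by blast
qed

text \<open>Eigenvectors for distinct eigenvalues are orthogonal, hence independent. Finiteness
  gives \<open>Min\<close> in \<open>lambda_min\<close> its meaning.\<close>

lemma finite_eigenvalues_symmetric:
  fixes A :: "real^'n^'n"
  assumes sym: "transpose A = A"
  shows "finite {\<mu>. eigenvalue A \<mu>}"
proof -
  define v where "v \<mu> = (SOME w. w \<noteq> 0 \<and> A *v w = \<mu> *s w)" for \<mu>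
  have v: "v \<mu> \<noteq> 0 \<and> A *v v \<mu> = \<mu> *s v \<mu>" if "eigenvalue A \<mu>" for \<mu>
    using that unfolding eigenvalue_def v_def by (rule someI_ex)
  have orth: "v \<mu> \<bullet> v \<nu> = 0" if "eigenvalue A \<mu>" "eigenvalue A \<nu>" "\<mu> \<noteq> \<nu>" for \<mu> \<nu>
  proof -
    have "\<nu> * (v \<mu> \<bullet> v \<nu>) = \<mu> * (v \<mu> \<bullet> v \<nu>)"
      using inner_symmetric_matrix[OF sym, of "v \<mu>" "v \<nu>"] v that
      by (simp add: scalar_mult_eq_scaleR)
    then show ?thesis using that by simp
  qed
  have inj: "inj_on v {\<mu>. eigenvalue A \<mu>}"
    by (rule inj_onI) (metis mem_Collect_eq orth v inner_eq_zero_iff)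
  have "pairwise orthogonal (v ` {\<mu>. eigenvalue A \<mu>})"
    unfolding pairwise_def orthogonal_def using orth by auto
  then have "independent (v ` {\<mu>. eigenvalue A \<mu>})"
    by (rule pairwise_orthogonal_independent) (use v in auto)
  then have "finite (v ` {\<mu>. eigenvalue A \<mu>})"
    by (rule independent_imp_finite)
  then show ?thesis
    using inj by (rule finite_imageD)
qed

text \<open>The Rayleigh minimum is itself an eigenvalue, so the least eigenvalue cannot exceed
  it.\<close>

lemma lambda_min_le_rayleigh:
  fixes A :: "real^'n^'n"
  assumes "transpose A = A"
  shows "lambda_min A * (v \<bullet> v) \<le> v \<bullet> (A *v v)"
proof -
  obtain \<mu> where \<mu>: "eigenvalue A \<mu>" "\<And>v. \<mu> * (v \<bullet> v) \<le> v \<bullet> (A *v v)"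
    using rayleigh_minimum_eigenvalue[OF assms] by blast
  then have "lambda_min A \<le> \<mu>"
    unfolding lambda_min_def using finite_eigenvalues_symmetric[OF assms] by (intro Min_le) auto
  then have "lambda_min A * (v \<bullet> v) \<le> \<mu> * (v \<bullet> v)"
    by (rule mult_right_mono) simp
  then show ?thesis using \<mu>(2)[of v] by linarith
qed

lemma matrix_vector_norm_bound:
  fixes A :: "real^'n^'m"
  obtains K where "K > 0" "\<And>v. norm (A *v v) \<le> K * norm v"
  using bounded_linear.pos_bounded[OF matrix_vector_mul_bounded_linear[of A]]
  by (metis mult.commute)

text \<open>Supplies the weight of the Lyapunov function. Substituting
  \<open>v = A *v (P *v v)\<close> transfers positivity from \<open>A\<close> to \<open>P\<close>,
  and \<open>c1\<close> is the Rayleigh minimum of \<open>P\<close>.\<close>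

lemma positive_definite_inverse:
  fixes A :: "real^'n^'n"
  assumes "symmetric_positive_definite A"
  obtains P c1 c2 where "P ** A = mat 1" "transpose P = P" "c1 > 0" "c2 > 0"
    "\<And>v. c1 * (v \<bullet> v) \<le> v \<bullet> (P *v v)" "\<And>v. v \<bullet> (P *v v) \<le> c2 * (v \<bullet> v)"
proof -
  have sym: "transpose A = A" and pos: "\<And>v. v \<noteq> 0 \<Longrightarrow> v \<bullet> (A *v v) > 0"
    using assms by (auto simp: symmetric_positive_definite_def)
  have "\<forall>v. A *v v = 0 \<longrightarrow> v = 0"
    using pos by fastforce
  then obtain P where PA: "P ** A = mat 1"
    using matrix_left_invertible_ker by blast
  then have AP: "A ** P = mat 1"
    using matrix_left_right_inverse by blast
  have "A ** transpose P = mat 1"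
    using arg_cong[OF PA, of transpose] by (simp add: matrix_transpose_mul sym)
  then have symP: "transpose P = P"
    by (metis PA matrix_mul_assoc matrix_mul_lid matrix_mul_rid)
  have posP: "v \<bullet> (P *v v) > 0" if "v \<noteq> 0" for v
  proof -
    have v: "A *v (P *v v) = v"
      by (simp add: matrix_vector_mul_assoc AP)
    then have "P *v v \<noteq> 0" using that by auto
    then show ?thesis
      using pos[of "P *v v"] by (simp add: v inner_commute)
  qed
  obtain \<mu> where \<mu>: "eigenvalue P \<mu>" "\<And>v. \<mu> * (v \<bullet> v) \<le> v \<bullet> (P *v v)"
    using rayleigh_minimum_eigenvalue[OF symP] by blast
  then obtain w where w: "w \<noteq> 0" "P *v w = \<mu> *s w"
    unfolding eigenvalue_def by blast
  then have "\<mu> * (w \<bullet> w) > 0"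
    using posP[of w] by (simp add: scalar_mult_eq_scaleR)
  then have "\<mu> > 0"
    using zero_less_mult_pos2[of \<mu> "w \<bullet> w"] w(1) by simp
  obtain K where K: "K > 0" "\<And>v. norm (P *v v) \<le> K * norm v"
    using matrix_vector_norm_bound by blast
  have "v \<bullet> (P *v v) \<le> K * (v \<bullet> v)" for v
  proof -
    have "v \<bullet> (P *v v) \<le> norm v * (K * norm v)"
      using norm_cauchy_schwarz[of v "P *v v"] K(2)[of v]
      by (meson mult_left_mono norm_ge_zero order_trans)
    then show ?thesis
      by (simp add: power2_norm_eq_inner[symmetric] power2_eq_square mult_ac)
  qed
  then show ?thesis
    using that PA symP \<open>\<mu> > 0\<close> K(1) \<mu>(2) by blast
qed

lemma transpose_replay_sum: "transpose (replay_sum Y ts) = replay_sum Y ts"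
proof -
  have "transpose (A + B) = transpose A + transpose B" for A B :: "real^'a^'a"
    by (simp add: transpose_def vec_eq_iff)
  moreover have "transpose (0 :: real^'a^'a) = 0"
    by (simp add: transpose_def vec_eq_iff)
  ultimately show ?thesis
    unfolding replay_sum_def
    by (induction ts) (simp_all add: matrix_transpose_mul)
qed

text \<open>\<open>D *v v\<close> has squared norm
  \<open>v \<bullet> ((transpose D ** D) *v v)\<close>, so the Gram matrix inherits injectivity from
  the full-rank \<open>D\<close> and is invertible.\<close>

lemma pseudoinverse_left_inverse:
  fixes D :: "real^'d^'n"
  assumes "rank D = CARD('d)"
  shows "pseudoinverse D ** D = mat 1"
proof -
  have "v = 0" if "(transpose D ** D) *v v = 0" for v
  proof -
    have "(D *v v) \<bullet> (D *v v) = (transpose D *v (D *v v)) \<bullet> v"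
      by (metis dot_lmul_matrix vector_transpose_matrix transpose_transpose)
    then have "D *v v = 0"
      using that by (simp add: matrix_vector_mul_assoc)
    then show ?thesis
      using assms by (metis full_rank_injective inj_eq matrix_vector_mult_0_right)
  qed
  then have "invertible (transpose D ** D)"
    unfolding invertible_left_inverse matrix_left_invertible_ker by blast
  then have "matrix_inv (transpose D ** D) ** (transpose D ** D) = mat 1"
    unfolding matrix_inv_def invertible_def by (rule someI2_ex) blast
  then show ?thesis
    by (simp add: pseudoinverse_def matrix_mul_assoc)
qed

subsection \<open>Linear systems with imaginary spectrum\<close>

text \<open>Horner's scheme for \<open>p(A) v\<close>, acting on vectors throughout.\<close>

definition matrix_poly :: "'a::field^'n^'n \<Rightarrow> 'a poly \<Rightarrow> 'a^'n \<Rightarrow> 'a^'n" where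
  "matrix_poly A p v = fold_coeffs (\<lambda>c w. c *s v + A *v w) p 0"

lemma matrix_poly_0 [simp]: "matrix_poly A 0 v = 0"
  by (simp add: matrix_poly_def)

lemma matrix_poly_pCons [simp]:
  "matrix_poly A (pCons c p) v = c *s v + A *v matrix_poly A p v"
  by (cases "p = 0 \<and> c = 0") (auto simp: matrix_poly_def)

lemma matrix_poly_add: "matrix_poly A (p + q) v = matrix_poly A p v + matrix_poly A q v"
  by (induction p q rule: poly_induct2)
     (simp_all add: matrix_vector_right_distrib vector_sadd_rdistrib)

lemma matrix_poly_smult: "matrix_poly A (smult c p) v = c *s matrix_poly A p v"
  by (induction p) (simp_all add: vector_add_ldistrib vector_scalar_commute vector_smult_assoc)

lemma matrix_poly_sum: "matrix_poly A (sum p I) v = (\<Sum>i\<in>I. matrix_poly A (p i) v)"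
  by (induction I rule: infinite_finite_induct) (simp_all add: matrix_poly_add)

lemma matrix_poly_monom: "matrix_poly A (monom c i) v = c *s (((*v) A ^^ i) v)"
  by (induction i) (simp_all add: monom_0 monom_Suc vector_scalar_commute)

lemma matrix_vector_mult_diff_mat: "(A - mat c) *v v = A *v v - c *s v"
  for A :: "'a::comm_ring_1^'n^'n"
proof -
  have "mat c *v v = c *s v"
    by (vector matrix_vector_mult_def mat_def) (simp add: if_distrib if_distribR cong: if_cong)
  then show ?thesis by (simp add: matrix_vector_mult_diff_rdistrib)
qed

lemma matrix_poly_commute:
  "matrix_poly A p ((A - mat c) *v v) = (A - mat c) *v matrix_poly A p v"
proof (induction p)
  case (pCons b p)
  have "A *v ((A - mat c) *v w) = (A - mat c) *v (A *v w)" for w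
    by (simp add: matrix_vector_mult_diff_mat matrix_vector_mult_diff_distrib vector_scalar_commute)
  then show ?case
    using pCons by (simp add: matrix_vector_right_distrib vector_scalar_commute)
qed simp

text \<open>Splitting off a root shifts the factor \<open>A - mat c\<close> onto the vector; this is
  what lowers the degree in the induction on the annihilating polynomial.\<close>

lemma matrix_poly_linear_factor:
  "matrix_poly A ([:- c, 1:] * p) v = matrix_poly A p ((A - mat c) *v v)"
proof -
  have "[:- c, 1:] * p = smult (- c) p + pCons 0 p"
    by simp
  then have "matrix_poly A ([:- c, 1:] * p) v = (A - mat c) *v matrix_poly A p v"
    by (simp only: matrix_poly_add matrix_poly_smult matrix_poly_pCons)
       (simp add: matrix_vector_mult_diff_mat)
  then show ?thesis by (simp add: matrix_poly_commute)
qed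

text \<open>Weak form of the Cayley-Hamilton theorem: the powers of \<open>A\<close> live in a finite-dimensional
  space, hence are linearly dependent.\<close>

lemma annihilating_polynomial:
  fixes A :: "complex^'n^'n"
  obtains p where "p \<noteq> 0" "\<And>v. matrix_poly A p v = 0"
proof -
  define P where "P i = ((**) A ^^ i) (mat 1)" for i
  have P: "P i *v v = ((*v) A ^^ i) v" for i v
    by (induction i) (simp_all add: P_def matrix_vector_mul_assoc[symmetric])
  show ?thesis
  proof (cases "inj P")
    case True
    then have "infinite (range P)"
      by (simp add: finite_image_iff)
    then have "dependent (range P)"
      using independent_imp_finite by blast
    \<comment> \<open>Dependence is over the reals, so the coefficients are real and are embedded
      into the complex numbers to form \<open>p\<close>.\<close>
    then obtain B r where B: "finite B" "B \<subseteq> range P" "(\<Sum>b\<in>B. r b *\<^sub>R b) = 0" "\<exists>b\<in>B. r b \<noteq> 0"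
      unfolding dependent_explicit by blast
    define I where "I = P -` B"
    have I: "finite I" "P ` I = B"
      using B True by (auto simp: I_def finite_vimageI)
    define p where "p = (\<Sum>i\<in>I. monom (complex_of_real (r (P i))) i)"
    have "matrix_poly A p v = 0" for v
    proof -
      have "matrix_poly A p v = (\<Sum>i\<in>I. (r (P i) *\<^sub>R P i) *v v)"
        unfolding p_def matrix_poly_sum matrix_poly_monom
        by (intro sum.cong refl)
           (simp add: P[symmetric] vec_eq_iff matrix_vector_mult_def sum_distrib_left
              scaleR_conv_of_real[where 'a=complex] mult.assoc)
      also have "\<dots> = (\<Sum>i\<in>I. r (P i) *\<^sub>R P i) *v v"
        using I(1) by (induction I rule: finite_induct)
          (simp_all add: matrix_vector_mult_add_rdistrib)
      also have "(\<Sum>i\<in>I. r (P i) *\<^sub>R P i) = (\<Sum>b\<in>P ` I. r b *\<^sub>R b)"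
        using True by (subst sum.reindex) (auto intro: inj_on_subset)
      finally show ?thesis by (simp add: I B)
    qed
    moreover have "p \<noteq> 0"
    proof -
      obtain i where i: "i \<in> I" "r (P i) \<noteq> 0"
        using B(4) I(2) by blast
      then have "coeff p i = r (P i)"
        using I(1) by (simp add: p_def coeff_sum if_distrib cong: if_cong)
      then show ?thesis using i(2) by auto
    qed
    ultimately show ?thesis using that by blast
  next
    case False
    \<comment> \<open>Two coinciding powers are annihilated by the difference of their
      monomials.\<close>
    then obtain i j where "i \<noteq> j" "P i = P j"
      unfolding inj_def by blast
    then have "matrix_poly A (monom 1 i + monom (- 1) j) v = 0" for v
      by (simp add: matrix_poly_add matrix_poly_monom flip: P)
    moreover have "coeff (monom (1 :: complex) i + monom (- 1) j) i \<noteq> 0"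
      using \<open>i \<noteq> j\<close> by simp
    ultimately show ?thesis using that by (metis coeff_0)
  qed
qed

text \<open>The inner product on complex vectors is the real one, so imaginary scalars act as
  rotations. This is how the spectral assumption enters.\<close>

lemma inner_vector_smult: "v \<bullet> (c *s v) = Re c * (v \<bullet> v)" for v :: "complex^'n"
  by (simp add: inner_vec_def inner_complex_def sum_distrib_left algebra_simps)

text \<open>One linear factor at a time: a root that is an eigenvalue leaves a forced equation
  \<open>w' = \<mu> w + y\<close> with \<open>y\<close> already bounded, any other root leaves an invertible \<open>A - \<mu>\<close>.\<close>

lemma imaginary_spectrum_subexponential_complex:
  fixes A :: "complex^'n^'n"
  assumes spec: "\<And>\<mu>. eigenvalue A \<mu> \<Longrightarrow> Re \<mu> = 0" and "r > 0"
    and "p \<noteq> 0" and "solution_on {0..} w (\<lambda>t. A *v w t)"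
    and "\<And>t. t \<ge> 0 \<Longrightarrow> matrix_poly A p (w t) = 0"
  shows "\<exists>C>0. \<forall>t\<ge>0. norm (w t) \<le> C * exp (r * t)"
  using assms(3-)
proof (induction "degree p" arbitrary: p w)
  case 0
  then obtain c where c: "p = [:c:]"
    by (metis degree_eq_zeroE)
  then have "w t = 0" if "t \<ge> 0" for t
    using 0(4)[OF that] 0(2) by simp
  then show ?case by (intro exI[of _ 1]) simp
next
  case (Suc n)
  then have "\<not> constant (poly p)"
    by (simp add: constant_degree)
  then obtain \<mu> where "poly p \<mu> = 0"
    using fundamental_theorem_of_algebra by blast
  then obtain q where q: "p = [:- \<mu>, 1:] * q"
    by (auto simp: poly_eq_0_iff_dvd)
  have "q \<noteq> 0"
    using q \<open>p \<noteq> 0\<close> by auto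
  have "degree p = degree [:- \<mu>, 1:] + degree q"
    unfolding q by (rule degree_mult_eq) (use \<open>q \<noteq> 0\<close> in auto)
  then have deg: "n = degree q"
    using Suc.hyps(2) by simp
  \<comment> \<open>\<open>A - mat \<mu>\<close> commutes with \<open>A\<close>, so \<open>y\<close>
    solves the same linear equation, and \<open>q\<close>, of smaller degree, annihilates
    it.\<close>
  define y where "y t = (A - mat \<mu>) *v w t" for t
  have "solution_on {0..} y (\<lambda>t. A *v y t)"
  proof (rule solution_on_cong)
    show "solution_on {0..} y (\<lambda>t. (A - mat \<mu>) *v (A *v w t))"
      unfolding y_def
      by (rule solution_on_linear[OF matrix_vector_mul_bounded_linear Suc.prems(2)])
    show "A *v y t = (A - mat \<mu>) *v (A *v w t)" for t
      by (simp add: y_def matrix_vector_mult_diff_mat matrix_vector_mult_diff_distrib vector_scalar_commute)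
  qed simp
  moreover have "matrix_poly A q (y t) = 0" if "t \<ge> 0" for t
    using Suc.prems(3)[OF that] unfolding q matrix_poly_linear_factor y_def .
  ultimately obtain C where C: "C > 0" "\<And>t. t \<ge> 0 \<Longrightarrow> norm (y t) \<le> C * exp (r * t)"
    using Suc.hyps(1)[OF deg \<open>q \<noteq> 0\<close>] by blast
  show ?case
  proof (cases "eigenvalue A \<mu>")
    case True
    \<comment> \<open>Here \<open>A *v w t - y t = \<mu> *s w t\<close>, whose inner product with
      \<open>w t\<close> is \<open>Re \<mu>\<close> times the squared norm, hence zero.\<close>
    then have "w t \<bullet> (A *v w t - y t) \<le> 0" for t
      using spec[OF True] by (simp add: y_def matrix_vector_mult_diff_mat inner_vector_smult)
    then show ?thesis
      using dissipative_forced_bound[OF Suc.prems(2) \<open>r > 0\<close> _ C(2)] by metis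
  next
    case False
    then have "\<forall>v. (A - mat \<mu>) *v v = 0 \<longrightarrow> v = 0"
      unfolding eigenvalue_def matrix_vector_mult_diff_mat by auto
    then obtain B where B: "B ** (A - mat \<mu>) = mat 1"
      using matrix_left_invertible_ker by blast
    then have w: "w t = B *v y t" for t
      by (simp add: y_def matrix_vector_mul_assoc)
    obtain K where K: "K > 0" "\<And>v. norm (B *v v) \<le> norm v * K"
      using bounded_linear.pos_bounded[OF matrix_vector_mul_bounded_linear[of B]] by blast
    have "norm (w t) \<le> (C * K) * exp (r * t)" if "t \<ge> 0" for t
    proof -
      have "norm (w t) \<le> norm (y t) * K"
        unfolding w by (rule K)
      also have "\<dots> \<le> (C * exp (r * t)) * K"
        using C(2)[OF that] K(1) by (intro mult_right_mono) auto
      finally show ?thesis by (simp add: mult_ac)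
    qed
    then show ?thesis
      using C(1) K(1) by (intro exI[of _ "C * K"]) auto
  qed
qed

text \<open>Componentwise embedding into complex vectors preserves norms and carries
  \<open>S\<close> to \<open>complex_matrix S\<close>, so the complex bound transfers. The constant
  depends on \<open>r\<close>, which may be arbitrarily small.\<close>

lemma imaginary_spectrum_subexponential:
  fixes S :: "real^'n^'n"
  assumes spec: "\<And>\<mu>. eigenvalue (complex_matrix S) \<mu> \<Longrightarrow> Re \<mu> = 0" and "r > 0"
    and sol: "solution_on {0..} w (\<lambda>t. S *v w t)"
  obtains C where "C > 0" "\<And>t. t \<ge> 0 \<Longrightarrow> norm (w t) \<le> C * exp (r * t)"
proof -
  define cv where "cv v = (\<chi> i. complex_of_real (v $ i))" for v :: "real^'n"
  have norm_cv: "norm (cv v) = norm v" for v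
    by (simp add: cv_def norm_vec_def)
  have "linear cv"
    by (rule linearI) (simp_all add: cv_def vec_eq_iff scaleR_conv_of_real[where 'a = complex])
  then have lin: "bounded_linear cv"
    by (simp add: linear_conv_bounded_linear)
  have "cv (S *v v) = complex_matrix S *v cv v" for v
    by (simp add: cv_def complex_matrix_def vec_eq_iff matrix_vector_mult_def)
  then have "solution_on {0..} (\<lambda>t. cv (w t)) (\<lambda>t. complex_matrix S *v cv (w t))"
    using solution_on_linear[OF lin sol] by simp
  moreover obtain p where "p \<noteq> 0" "\<And>v. matrix_poly (complex_matrix S) p v = 0"
    using annihilating_polynomial by blast
  ultimately have "\<exists>C>0. \<forall>t\<ge>0. norm (cv (w t)) \<le> C * exp (r * t)"
    using spec \<open>r > 0\<close> by (intro imaginary_spectrum_subexponential_complex)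
  then show ?thesis
    using that unfolding norm_cv by blast
qed

subsection \<open>Filtered signals and the replay law\<close>

lemma hconcat_vconcat: "hconcat A B *v vconcat v w = A *v v + B *v w"
  by (simp add: vec_eq_iff hconcat_def vconcat_def matrix_vector_mult_def
      UNIV_Plus_UNIV[symmetric] sum.Plus del: UNIV_Plus_UNIV)

text \<open>The residual \<open>q\<close> of the identity satisfies \<open>q' = - a q\<close> with
  \<open>q 0 = 0\<close>, since \<open>\<rho>\<close> starts at \<open>x 0\<close> and the other
  filters at zero. Here \<open>F\<close> is the known part of the plant dynamics, not a
  matrix.\<close>

lemma filtered_identity:
  assumes a: "a > 0"
    and x: "solution_on {0..} x (\<lambda>t. F t + D *v \<epsilon>\<^sub>T t)"
    and h: "solution_on {0..} h (\<lambda>t. - a *\<^sub>R h t + z t)" "h 0 = 0"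
    and \<phi>z: "\<And>t. t \<ge> 0 \<Longrightarrow> \<phi> *v z t = F t"
    and l: "solution_on {0..} l (\<lambda>t. - a *\<^sub>R l t + x t)" "l 0 = 0"
    and \<rho>: "solution_on {0..} \<rho> (\<lambda>t. - a *\<^sub>R \<rho> t)" "\<rho> 0 = x 0"
    and \<epsilon>: "solution_on {0..} \<epsilon> (\<lambda>t. - a *\<^sub>R \<epsilon> t + \<epsilon>\<^sub>T t)" "\<epsilon> 0 = 0"
    and "t \<ge> 0"
  shows "x t = \<phi> *v h t + a *\<^sub>R l t + (D::real^'d^'n) *v \<epsilon> t + \<rho> t"
proof -
  define q where "q t = x t - \<phi> *v h t - a *\<^sub>R l t - D *v \<epsilon> t - \<rho> t" for t
  have "solution_on {0..} q (\<lambda>t. - a *\<^sub>R q t)"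
  proof (rule solution_on_cong)
    show "solution_on {0..} q (\<lambda>t. (F t + D *v \<epsilon>\<^sub>T t) - \<phi> *v (- a *\<^sub>R h t + z t)
        - a *\<^sub>R (- a *\<^sub>R l t + x t) - D *v (- a *\<^sub>R \<epsilon> t + \<epsilon>\<^sub>T t) - (- a *\<^sub>R \<rho> t))"
      unfolding q_def
      by (intro solution_on_diff x \<rho> solution_on_linear[OF matrix_vector_mul_bounded_linear]
          solution_on_linear[OF bounded_linear_scaleR_right] h l \<epsilon>)
    show "- a *\<^sub>R q t = (F t + D *v \<epsilon>\<^sub>T t) - \<phi> *v (- a *\<^sub>R h t + z t)
        - a *\<^sub>R (- a *\<^sub>R l t + x t) - D *v (- a *\<^sub>R \<epsilon> t + \<epsilon>\<^sub>T t) - (- a *\<^sub>R \<rho> t)"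
      if "t \<in> {0..}" for t
      using \<phi>z[of t] that
      by (simp add: q_def matrix_vector_right_distrib matrix_vector_mult_scaleR
          vec.neg algebra_simps)
  qed simp
  moreover have "q 0 = 0"
    by (simp add: q_def h l \<epsilon> \<rho>)
  ultimately have "q t = 0"
    using zero_solution_unique a \<open>t \<ge> 0\<close> by blast
  then show ?thesis by (simp add: q_def algebra_simps)
qed

definition unstack :: "real^('c \<times> 'r) \<Rightarrow> real^'c^'r" where
  "unstack v = (\<chi> i j. v $ (j, i))"

lemma unstack_stack_columns [simp]: "unstack (stack_columns A) = A"
  by (simp add: unstack_def stack_columns_def vec_eq_iff)

text \<open>Serves to carry the decay of the stacked parameter error back to the matrix
  \<open>S_err\<close>.\<close>

lemma bounded_linear_unstack: "bounded_linear unstack"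
proof -
  have "linear unstack"
    by (rule linearI) (simp_all add: unstack_def vec_eq_iff)
  then show ?thesis by (simp add: linear_conv_bounded_linear)
qed

lemma bounded_bilinear_matrix_vector: "bounded_bilinear (\<lambda>(A :: real^'c^'r) v. A *v v)"
proof -
  have "bilinear (\<lambda>(A :: real^'c^'r) v. A *v v)"
    unfolding bilinear_def
    by (auto intro!: linearI simp: matrix_vector_right_distrib matrix_vector_mult_add_rdistrib
        matrix_vector_mult_scaleR scaleR_matrix_vector_assoc)
  then show ?thesis by (simp add: bilinear_conv_bounded_bilinear)
qed

lemma filtered_subexponential:
  assumes "a > 0" "r > 0"
    and \<epsilon>: "solution_on {0..} \<epsilon> (\<lambda>t. - a *\<^sub>R \<epsilon> t + \<epsilon>\<^sub>T t)"
    and "\<And>t. t \<ge> 0 \<Longrightarrow> norm (\<epsilon>\<^sub>T t) \<le> C * exp (r * t)"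
  obtains K where "K > 0" "\<And>t. t \<ge> 0 \<Longrightarrow> norm (\<epsilon> t :: 'a::real_inner) \<le> K * exp (r * t)"
proof (rule dissipative_forced_bound[OF \<epsilon> \<open>r > 0\<close> _ assms(4)])
  show "\<epsilon> t \<bullet> (- a *\<^sub>R \<epsilon> t + \<epsilon>\<^sub>T t - \<epsilon>\<^sub>T t) \<le> 0" for t
    using \<open>a > 0\<close> by simp
qed (use that in auto)

section \<open>Lyapunov estimate for the replay law\<close>

lemma young_half:
  fixes v w :: "'a::real_inner"
  assumes "a > 0"
  shows "v \<bullet> w \<le> a / 2 * (v \<bullet> v) + (norm w)\<^sup>2 / (2 * a)"
proof -
  have "0 \<le> (norm (a *\<^sub>R v - w))\<^sup>2 / (2 * a)"
    using assms by simp
  also have "(norm (a *\<^sub>R v - w))\<^sup>2 = a\<^sup>2 * (v \<bullet> v) - 2 * a * (v \<bullet> w) + (norm w)\<^sup>2"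
    unfolding power2_norm_eq_inner
    by (simp add: inner_diff_left inner_diff_right inner_commute[of w v] power2_eq_square algebra_simps)
  also have "\<dots> / (2 * a) = a / 2 * (v \<bullet> v) - v \<bullet> w + (norm w)\<^sup>2 / (2 * a)"
    using assms by (simp add: field_simps power2_eq_square)
  finally show ?thesis by simp
qed

text \<open>Weighting \<open>s\<close> by the inverse of \<open>\<Gamma>\<close> makes the two
  regressor terms exact negatives of each other. No bound on \<open>R\<close> is therefore required,
  which matters because the regressor may grow with the filtered disturbance.\<close>

lemma replay_lyapunov_decay:
  fixes e \<eta> :: "real \<Rightarrow> real^'n" and s :: "real \<Rightarrow> real^'k" and R :: "real \<Rightarrow> real^'k^'n"
    and M :: "real \<Rightarrow> real^'k^'k" and \<Gamma> :: "real^'k^'k"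
  assumes "a > 0" "\<kappa> > 0" "\<omega> > 0" "T \<ge> 0" and pd: "symmetric_positive_definite \<Gamma>"
    and e: "solution_on {T..} e (\<lambda>t. - a *\<^sub>R e t + R t *v s t + \<eta> t)"
    and s: "solution_on {T..} s
        (\<lambda>t. - (\<Gamma> *v (transpose (R t) *v e t) + \<kappa> *\<^sub>R (\<Gamma> *v (M t *v s t))))"
    and \<eta>: "\<And>t. t \<ge> T \<Longrightarrow> norm (\<eta> t) \<le> C * exp (- a * t)"
    and M: "\<And>t. t > T \<Longrightarrow> \<omega> * (s t \<bullet> s t) \<le> s t \<bullet> (M t *v s t)"
  obtains K p where "K > 0" "p > 0" "\<And>t. t \<ge> T \<Longrightarrow> norm (s t) \<le> K * exp (- p * t)"
proof -
  obtain P c1 c2 where P: "P ** \<Gamma> = mat 1" "transpose P = P" "c1 > 0" "c2 > 0"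
    "\<And>v. c1 * (v \<bullet> v) \<le> v \<bullet> (P *v v)" "\<And>v. v \<bullet> (P *v v) \<le> c2 * (v \<bullet> v)"
    using positive_definite_inverse[OF pd] by metis
  define V where "V t = e t \<bullet> e t + s t \<bullet> (P *v s t)" for t
  define e' where "e' t = - a *\<^sub>R e t + R t *v s t + \<eta> t" for t
  define s' where "s' t = - (\<Gamma> *v (transpose (R t) *v e t) + \<kappa> *\<^sub>R (\<Gamma> *v (M t *v s t)))" for t
  \<comment> \<open>Young's inequality spends half of the damping \<open>2 * a\<close> on
    \<open>\<eta>\<close>, leaving rate \<open>a\<close> for \<open>e\<close>; the replay term gives
    \<open>2 * \<kappa> * \<omega>\<close> against a weight of at most \<open>c2\<close>.\<close>
  define p where "p = min a (2 * \<kappa> * \<omega> / c2)"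
  have p: "p > 0" "p \<le> a" "p * c2 \<le> 2 * \<kappa> * \<omega>"
    using assms P by (auto simp: p_def min_def field_simps)
  have P\<Gamma>: "P *v (\<Gamma> *v v) = v" for v
    by (simp add: matrix_vector_mul_assoc P(1))
  have Ps': "P *v s' t = - (transpose (R t) *v e t + \<kappa> *\<^sub>R (M t *v s t))" for t
    unfolding s'_def vec.neg matrix_vector_right_distrib matrix_vector_mult_scaleR P\<Gamma> ..
  have V: "solution_on {T..} V (\<lambda>t. (e t \<bullet> e' t + e' t \<bullet> e t) + (s t \<bullet> (P *v s' t) + s' t \<bullet> (P *v s t)))"
    unfolding V_def e'_def s'_def
    by (intro solution_on_add solution_on_bilinear[OF bounded_bilinear_inner]
        solution_on_linear[OF matrix_vector_mul_bounded_linear] e s)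
  have le: "(e t \<bullet> e' t + e' t \<bullet> e t) + (s t \<bullet> (P *v s' t) + s' t \<bullet> (P *v s t))
      \<le> - p * V t + C\<^sup>2 / a * exp ((- 2 * a) * t)" if "t > T" for t
  proof -
    have "s' t \<bullet> (P *v s t) = s t \<bullet> (P *v s' t)"
      using inner_symmetric_matrix[OF P(2), of "s' t" "s t"] by (simp add: inner_commute)
    moreover have "s t \<bullet> (transpose (R t) *v e t) = e t \<bullet> (R t *v s t)"
      by (metis dot_lmul_matrix vector_transpose_matrix transpose_transpose inner_commute)
    ultimately have eq: "(e t \<bullet> e' t + e' t \<bullet> e t) + (s t \<bullet> (P *v s' t) + s' t \<bullet> (P *v s t))
        = - 2 * a * (e t \<bullet> e t) + 2 * (e t \<bullet> \<eta> t) - 2 * \<kappa> * (s t \<bullet> (M t *v s t))"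
      unfolding Ps' by (simp add: e'_def inner_add_right inner_add_left inner_commute algebra_simps)
    have "(norm (\<eta> t))\<^sup>2 \<le> (C * exp (- a * t))\<^sup>2"
      using \<eta>[of t] that by (intro power_mono) auto
    also have "(C * exp (- a * t))\<^sup>2 = C\<^sup>2 * exp ((- 2 * a) * t)"
      by (simp add: power_mult_distrib exp_double[symmetric] mult.assoc)
    finally have "(norm (\<eta> t))\<^sup>2 / a \<le> C\<^sup>2 / a * exp ((- 2 * a) * t)"
      using \<open>a > 0\<close> by (simp add: divide_right_mono)
    moreover have "2 * (e t \<bullet> \<eta> t) \<le> a * (e t \<bullet> e t) + (norm (\<eta> t))\<^sup>2 / a"
      using young_half[OF \<open>a > 0\<close>, of "e t" "\<eta> t"] by simp
    moreover have "p * (e t \<bullet> e t) \<le> a * (e t \<bullet> e t)"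
      using p by (intro mult_right_mono) auto
    moreover have "p * (s t \<bullet> (P *v s t)) \<le> 2 * \<kappa> * (s t \<bullet> (M t *v s t))"
    proof -
      have "p * (s t \<bullet> (P *v s t)) \<le> p * (c2 * (s t \<bullet> s t))"
        using p(1) P(6) by (intro mult_left_mono) auto
      also have "\<dots> \<le> 2 * \<kappa> * \<omega> * (s t \<bullet> s t)"
        unfolding mult.assoc[symmetric] using p(3) by (intro mult_right_mono) auto
      also have "\<dots> \<le> 2 * \<kappa> * (s t \<bullet> (M t *v s t))"
        using M[OF that] \<open>\<kappa> > 0\<close> by (simp add: mult.assoc)
      finally show ?thesis .
    qed
    ultimately show ?thesis
      unfolding eq V_def by (simp add: algebra_simps)
  qed
  \<comment> \<open>No resonance occurs: \<open>p \<le> a < 2 * a\<close>, so the forcing decays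
    strictly faster than the rate \<open>p\<close>.\<close>
  obtain B where B: "B > 0" "\<And>t. t \<ge> T \<Longrightarrow> V t \<le> B * exp (- p * t)"
    using solution_on_comparison[OF V \<open>T \<ge> 0\<close> le, of "- p"] p \<open>a > 0\<close> by auto
  have "norm (s t) \<le> sqrt (B / c1) * exp (- (p / 2) * t)" if "t \<ge> T" for t
  proof (rule exp_bound_from_square)
    have "c1 * (s t \<bullet> s t) \<le> B * exp (- p * t)"
      using B(2)[OF that] P(5)[of "s t"] inner_ge_zero[of "e t"] unfolding V_def by linarith
    then show "(norm (s t))\<^sup>2 \<le> B / c1 * exp (2 * - (p / 2) * t)"
      using P(3) by (simp add: power2_norm_eq_inner field_simps)
  qed (use B P in simp)
  then show ?thesis
    using that[of "sqrt (B / c1)" "p / 2"] B(1) P(3) p(1) by simp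
qed

theorem theorem2:
  fixes f :: "real^'n \<Rightarrow> real^'n" and g :: "real^'n \<Rightarrow> real^'m^'n"
    and \<theta> :: "real^'p^'n" and \<psi> :: "real^'q^'n"
    and \<xi> :: "real^'n \<Rightarrow> real^'p" and \<zeta> :: "real^'n \<Rightarrow> real^'m^'q"
    and \<phi> :: "real^('p + 'q)^'n" and z :: "real^'n \<Rightarrow> real^'m \<Rightarrow> real^('p + 'q)"
    and D :: "real^'d^'n" and F :: "real^'n^'d" and S :: "real^'d^'d"
    and \<Gamma> :: "real^('d \<times> 'd)^('d \<times> 'd)"
    and a \<kappa> t0 \<Delta>t :: real
    and x :: "real \<Rightarrow> real^'n" and u :: "real \<Rightarrow> real^'m" and \<epsilon>\<^sub>T :: "real \<Rightarrow> real^'d"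
    and h :: "real \<Rightarrow> real^('p + 'q)" and l \<rho> \<epsilon>_bar :: "real \<Rightarrow> real^'n" and \<epsilon> :: "real \<Rightarrow> real^'d"
    and Y :: "real \<Rightarrow> real^('d \<times> 'd)^'n" and stack :: "real \<Rightarrow> real list"
    and \<epsilon>\<^sub>T_hat \<rho>\<^sub>\<Delta>_hat \<epsilon>_hat :: "real \<Rightarrow> real^'d"
    and x_hat \<epsilon>_bar_hat e :: "real \<Rightarrow> real^'n"
    and S_hat S_err :: "real \<Rightarrow> real^'d^'d"
  assumes stabilizable: "stabilizable f g"
    and f0: "f 0 = 0"
    and f_lipschitz: "local_lipschitz (UNIV::real set) UNIV (\<lambda>_. f)"
    and g_lipschitz: "local_lipschitz (UNIV::real set) UNIV (\<lambda>_. g)"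
    and g_rank: "\<And>y. rank (g y) = CARD('m)"
    and f_param: "\<And>y. f y = \<theta> *v \<xi> y"
    and g_param: "\<And>y. g y = \<psi> ** \<zeta> y"
    and \<phi>_eq: "\<phi> = hconcat \<theta> \<psi>"
    and z_eq: "\<And>y v. z y v = vconcat (\<xi> y) (\<zeta> y *v v)"
    and S_spectrum: "\<And>\<mu>. eigenvalue (complex_matrix S) \<mu> \<Longrightarrow> Re \<mu> = 0"
    and D_rank: "rank D = CARD('d)"
    and F_eq: "F = pseudoinverse D"
    and a_pos: "a > 0" and \<kappa>_pos: "\<kappa> > 0"
    and \<Gamma>_pd: "symmetric_positive_definite \<Gamma>"
    and t0_nonneg: "t0 \<ge> 0" and \<Delta>t_pos: "\<Delta>t > 0"
    \<comment> \<open>plant and disturbance generator\<close>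
    and x_ode: "solution_on {0..} x (\<lambda>t. f (x t) + g (x t) *v u t + D *v \<epsilon>\<^sub>T t)"
    and \<epsilon>\<^sub>T_ode: "solution_on {0..} \<epsilon>\<^sub>T (\<lambda>t. S *v \<epsilon>\<^sub>T t)"
    \<comment> \<open>filtered signals\<close>
    and h_ode: "solution_on {0..} h (\<lambda>t. - a *\<^sub>R h t + z (x t) (u t))" and h0: "h 0 = 0"
    and l_ode: "solution_on {0..} l (\<lambda>t. - a *\<^sub>R l t + x t)" and l0: "l 0 = 0"
    and \<rho>_ode: "solution_on {0..} \<rho> (\<lambda>t. - a *\<^sub>R \<rho> t)" and \<rho>0: "\<rho> 0 = x 0"
    and \<epsilon>_ode: "solution_on {0..} \<epsilon> (\<lambda>t. - a *\<^sub>R \<epsilon> t + \<epsilon>\<^sub>T t)" and \<epsilon>0: "\<epsilon> 0 = 0"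
    and \<epsilon>_bar_eq: "\<And>t. t \<ge> 0 \<Longrightarrow> \<epsilon>_bar t = D *v \<epsilon> t"
    \<comment> \<open>recorded data\<close>
    and Y_eq: "\<And>t. t \<ge> t0 \<Longrightarrow> Y t = windowed_data F D \<epsilon>_bar t0 \<Delta>t t"
    and history: "history_stack t0 stack"
    \<comment> \<open>disturbance observer\<close>
    and \<epsilon>\<^sub>T_hat_eq: "\<And>t. t \<ge> 0 \<Longrightarrow> \<epsilon>\<^sub>T_hat t = (S_hat t + a *\<^sub>R mat 1) *v \<epsilon> t + \<rho>\<^sub>\<Delta>_hat t"
    and \<rho>\<^sub>\<Delta>_hat_ode: "solution_on {0..} \<rho>\<^sub>\<Delta>_hat (\<lambda>t. - a *\<^sub>R \<rho>\<^sub>\<Delta>_hat t)"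
    and \<rho>\<^sub>\<Delta>_hat0: "\<rho>\<^sub>\<Delta>_hat 0 = \<epsilon>\<^sub>T_hat 0"
    \<comment> \<open>auxiliary dynamics\<close>
    and x_hat_eq: "\<And>t. t \<ge> 0 \<Longrightarrow> x_hat t = \<phi> *v h t + a *\<^sub>R l t + \<epsilon>_bar_hat t + \<rho> t"
    and \<epsilon>_hat_ode: "solution_on {0..} \<epsilon>_hat (\<lambda>t. - a *\<^sub>R \<epsilon>_hat t + \<epsilon>\<^sub>T_hat t)"
    and \<epsilon>_bar_hat_eq: "\<And>t. t \<ge> 0 \<Longrightarrow> \<epsilon>_bar_hat t = D *v \<epsilon>_hat t"
    \<comment> \<open>experience-replay adaptive law\<close>
    and e_eq: "\<And>t. t \<ge> 0 \<Longrightarrow> e t = x t - x_hat t"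
    and S_err_eq: "\<And>t. t \<ge> 0 \<Longrightarrow> S_err t = S - S_hat t"
    and S_hat_ode: "solution_on {0..} (\<lambda>t. stack_columns (S_hat t))
          (\<lambda>t. \<Gamma> *v (transpose (regressor F D (\<epsilon>_bar t)) *v e t) +
               \<kappa> *\<^sub>R (\<Gamma> *v (replay_sum Y (stack t) *v stack_columns (S_err t))))"
    \<comment> \<open>sufficient excitation over a finite duration\<close>
    and excitation: "\<exists>\<omega>>0. \<exists>T>t0 + \<Delta>t. \<forall>t>T. lambda_min (replay_sum Y (stack t)) > \<omega>"
  shows "exponentially_convergent S_err \<and>
         exponentially_convergent (\<lambda>t. \<epsilon>\<^sub>T t - \<epsilon>\<^sub>T_hat t)"
proof -
  obtain \<omega> T where \<omega>: "\<omega> > 0" and T: "T > t0 + \<Delta>t"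
    and exc: "\<And>t. t > T \<Longrightarrow> lambda_min (replay_sum Y (stack t)) > \<omega>"
    using excitation by blast
  have "T \<ge> 0"
    using T t0_nonneg \<Delta>t_pos by simp
  have x_eq: "x t = \<phi> *v h t + a *\<^sub>R l t + D *v \<epsilon> t + \<rho> t" if "t \<ge> 0" for t
  proof (rule filtered_identity[OF a_pos x_ode h_ode h0 _ l_ode l0 \<rho>_ode \<rho>0 \<epsilon>_ode \<epsilon>0 that])
    show "\<phi> *v z (x t) (u t) = f (x t) + g (x t) *v u t" for t
      by (simp add: \<phi>_eq z_eq hconcat_vconcat f_param g_param matrix_vector_mul_assoc)
  qed
  have e: "e t = D *v (\<epsilon> t - \<epsilon>_hat t)" if "t \<ge> 0" for t
    using that by (simp add: e_eq x_hat_eq x_eq \<epsilon>_bar_hat_eq matrix_vector_mult_diff_distrib)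
  \<comment> \<open>With the true \<open>S\<close>, the mismatch
    \<open>\<epsilon>\<^sub>T - (S + a I) \<epsilon>\<close> obeys the same decay equation as
    \<open>\<rho>\<^sub>\<Delta>_hat\<close>, so their difference decays at rate \<open>a\<close>
    whatever the initial estimates.\<close>
  define \<rho>\<^sub>\<Delta>_err where "\<rho>\<^sub>\<Delta>_err t = \<epsilon>\<^sub>T t - (S + a *\<^sub>R mat 1) *v \<epsilon> t - \<rho>\<^sub>\<Delta>_hat t" for t
  have mat_a: "(a *\<^sub>R mat 1) *v v = a *\<^sub>R v" for v :: "real^'d"
    by (simp add: scaleR_matrix_vector_assoc[symmetric])
  have \<epsilon>\<^sub>T_err: "\<epsilon>\<^sub>T t - \<epsilon>\<^sub>T_hat t = S_err t *v \<epsilon> t + \<rho>\<^sub>\<Delta>_err t" if "t \<ge> 0" for t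
    using that by (simp add: \<epsilon>\<^sub>T_hat_eq S_err_eq \<rho>\<^sub>\<Delta>_err_def mat_a
        matrix_vector_mult_add_rdistrib matrix_vector_mult_diff_rdistrib)
  have "solution_on {0..} \<rho>\<^sub>\<Delta>_err (\<lambda>t. - a *\<^sub>R \<rho>\<^sub>\<Delta>_err t)"
  proof (rule solution_on_cong)
    show "solution_on {0..} \<rho>\<^sub>\<Delta>_err
        (\<lambda>t. S *v \<epsilon>\<^sub>T t - (S + a *\<^sub>R mat 1) *v (- a *\<^sub>R \<epsilon> t + \<epsilon>\<^sub>T t) - (- a *\<^sub>R \<rho>\<^sub>\<Delta>_hat t))"
      unfolding \<rho>\<^sub>\<Delta>_err_def
      by (intro solution_on_diff \<epsilon>\<^sub>T_ode \<rho>\<^sub>\<Delta>_hat_ode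
          solution_on_linear[OF matrix_vector_mul_bounded_linear] \<epsilon>_ode)
    show "- a *\<^sub>R \<rho>\<^sub>\<Delta>_err t =
        S *v \<epsilon>\<^sub>T t - (S + a *\<^sub>R mat 1) *v (- a *\<^sub>R \<epsilon> t + \<epsilon>\<^sub>T t) - (- a *\<^sub>R \<rho>\<^sub>\<Delta>_hat t)" for t
      by (simp add: \<rho>\<^sub>\<Delta>_err_def mat_a matrix_vector_mult_add_rdistrib
          matrix_vector_mult_diff_distrib matrix_vector_mult_scaleR algebra_simps)
  qed simp
  then obtain C where C: "C > 0" "\<And>t. t \<ge> 0 \<Longrightarrow> norm (\<rho>\<^sub>\<Delta>_err t) \<le> C * exp (- a * t)"
    using exponential_decay_bound[OF _ a_pos] by blast

  define s where "s t = stack_columns (S_err t)" for t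
  define R where "R t = regressor F D (\<epsilon>_bar t)" for t
  have F\<epsilon>: "F *v (D *v v) = v" for v
    by (simp add: F_eq matrix_vector_mul_assoc pseudoinverse_left_inverse[OF D_rank])
  \<comment> \<open>As \<open>F\<close> is a left inverse of \<open>D\<close>, it recovers
    \<open>\<epsilon>\<close> from \<open>\<epsilon>_bar\<close>, so the regressor reproduces
    exactly the term by which \<open>S_err\<close> drives \<open>e\<close>.\<close>
  have Rs: "R t *v s t = D *v (S_err t *v \<epsilon> t)" if "t \<ge> 0" for t
    using that by (simp add: R_def s_def regressor_stack_columns \<epsilon>_bar_eq F\<epsilon>)
  have e_ode: "solution_on {0..} e (\<lambda>t. - a *\<^sub>R e t + R t *v s t + D *v \<rho>\<^sub>\<Delta>_err t)"
  proof (rule solution_on_cong)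
    show "solution_on {0..} (\<lambda>t. D *v (\<epsilon> t - \<epsilon>_hat t))
        (\<lambda>t. D *v ((- a *\<^sub>R \<epsilon> t + \<epsilon>\<^sub>T t) - (- a *\<^sub>R \<epsilon>_hat t + \<epsilon>\<^sub>T_hat t)))"
      by (intro solution_on_linear[OF matrix_vector_mul_bounded_linear] solution_on_diff
          \<epsilon>_ode \<epsilon>_hat_ode)
    show "- a *\<^sub>R e t + R t *v s t + D *v \<rho>\<^sub>\<Delta>_err t =
        D *v ((- a *\<^sub>R \<epsilon> t + \<epsilon>\<^sub>T t) - (- a *\<^sub>R \<epsilon>_hat t + \<epsilon>\<^sub>T_hat t))" if "t \<in> {0..}" for t
    proof -
      have "(- a *\<^sub>R \<epsilon> t + \<epsilon>\<^sub>T t) - (- a *\<^sub>R \<epsilon>_hat t + \<epsilon>\<^sub>T_hat t) =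
          - a *\<^sub>R (\<epsilon> t - \<epsilon>_hat t) + (S_err t *v \<epsilon> t + \<rho>\<^sub>\<Delta>_err t)"
        using \<epsilon>\<^sub>T_err[of t] that by (simp add: algebra_simps)
      then show ?thesis
        using that e[of t] Rs[of t]
        by (simp only: matrix_vector_right_distrib matrix_vector_mult_scaleR) simp
    qed
  qed (use e in auto)
  have s_ode: "solution_on {0..} s (\<lambda>t. - (\<Gamma> *v (transpose (R t) *v e t) +
      \<kappa> *\<^sub>R (\<Gamma> *v (replay_sum Y (stack t) *v s t))))"
  \<comment> \<open>\<open>S\<close> is constant, so passing to the error only flips the sign of the
    adaptive law; this sign makes the replay term dissipative.\<close>
  proof (rule solution_on_cong[OF solution_on_diff[OF solution_on_const[of _ "stack_columns S"] S_hat_ode]])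
    show "s t = stack_columns S - stack_columns (S_hat t)" if "t \<in> {0..}" for t
      using that by (simp add: s_def S_err_eq stack_columns_def vec_eq_iff)
  qed (simp add: R_def s_def)
  have replay: "\<omega> * (s t \<bullet> s t) \<le> s t \<bullet> (replay_sum Y (stack t) *v s t)" if "t > T" for t
  proof -
    have "\<omega> * (s t \<bullet> s t) \<le> lambda_min (replay_sum Y (stack t)) * (s t \<bullet> s t)"
      using exc[OF that] by (intro mult_right_mono) auto
    also have "\<dots> \<le> s t \<bullet> (replay_sum Y (stack t) *v s t)"
      by (rule lambda_min_le_rayleigh) (rule transpose_replay_sum)
    finally show ?thesis .
  qed
  obtain K where K: "K > 0" "\<And>v. norm (D *v v) \<le> K * norm v"
    using matrix_vector_norm_bound by blast
  have \<eta>: "norm (D *v \<rho>\<^sub>\<Delta>_err t) \<le> (K * C) * exp (- a * t)" if "t \<ge> T" for t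
  proof -
    have "norm (D *v \<rho>\<^sub>\<Delta>_err t) \<le> K * norm (\<rho>\<^sub>\<Delta>_err t)"
      by (rule K)
    also have "\<dots> \<le> K * (C * exp (- a * t))"
      using C(2)[of t] K(1) that \<open>T \<ge> 0\<close> by (intro mult_left_mono) auto
    finally show ?thesis by (simp add: mult.assoc)
  qed
  \<comment> \<open>Excitation is available only after \<open>T\<close>, so the error equations are
    restricted to that half-line.\<close>
  have "{T..} \<subseteq> {0..}"
    using \<open>T \<ge> 0\<close> by auto
  then obtain B p where B: "B > 0" "p > 0" "\<And>t. t \<ge> T \<Longrightarrow> norm (s t) \<le> B * exp (- p * t)"
    using replay_lyapunov_decay[OF a_pos \<kappa>_pos \<omega> \<open>T \<ge> 0\<close> \<Gamma>_pd
        solution_on_subset[OF e_ode] solution_on_subset[OF s_ode] \<eta> replay]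
    by blast
  obtain L where L: "L > 0" "\<And>v. norm (unstack v :: real^'d^'d) \<le> norm v * L"
    using bounded_linear.pos_bounded[OF bounded_linear_unstack] by blast
  have S_bound: "norm (S_err t) \<le> (B * L) * exp (- p * t)" if "t \<ge> T" for t
  proof -
    have "norm (S_err t) \<le> norm (s t) * L"
      using L(2)[of "s t"] by (simp add: s_def)
    also have "\<dots> \<le> (B * exp (- p * t)) * L"
      using B(3)[OF that] L(1) by (intro mult_right_mono) auto
    finally show ?thesis by (simp add: mult_ac)
  qed
  have S_conv: "exponentially_convergent S_err"
    unfolding exponentially_convergent_def eventually_at_top_linorder
    using S_bound B(1,2) L(1)
    by (intro exI[of _ "B * L"] conjI exI[of _ p] exI[of _ T] allI impI) auto

  \<comment> \<open>Allowing \<open>\<epsilon>\<close> to grow at half the decay rate of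
    \<open>S_err\<close> leaves the product decaying at rate \<open>p / 2\<close>.\<close>
  have "p / 2 > 0"
    using B(2) by simp
  obtain E where E: "\<And>t. t \<ge> 0 \<Longrightarrow> norm (\<epsilon>\<^sub>T t) \<le> E * exp ((p / 2) * t)"
    using imaginary_spectrum_subexponential[OF S_spectrum \<open>p / 2 > 0\<close> \<epsilon>\<^sub>T_ode] by blast
  obtain G where G: "G > 0" "\<And>t. t \<ge> 0 \<Longrightarrow> norm (\<epsilon> t) \<le> G * exp ((p / 2) * t)"
    using filtered_subexponential[OF a_pos \<open>p / 2 > 0\<close> \<epsilon>_ode E] by blast
  obtain N where N: "N > 0" "\<And>(A :: real^'d^'d) v. norm (A *v v) \<le> norm A * norm v * N"
    using bounded_bilinear.pos_bounded[OF bounded_bilinear_matrix_vector] by blast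
  \<comment> \<open>The slower of the rates of \<open>S_err t *v \<epsilon> t\<close> and
    \<open>\<rho>\<^sub>\<Delta>_err t\<close>.\<close>
  define q where "q = min (p / 2) a"
  have "norm (\<epsilon>\<^sub>T t - \<epsilon>\<^sub>T_hat t) \<le> (B * L * G * N + C) * exp (- q * t)" if "t \<ge> T" for t
  proof -
    have "t \<ge> 0"
      using that \<open>T \<ge> 0\<close> by simp
    have ex: "exp (- p * t) * exp ((p / 2) * t) = exp (- (p / 2) * t)"
      by (simp add: exp_add[symmetric] field_simps)
    have "q * t \<le> p / 2 * t" "q * t \<le> a * t"
      using \<open>t \<ge> 0\<close> by (intro mult_right_mono; simp add: q_def)+
    then have q: "exp (- (p / 2) * t) \<le> exp (- q * t)" "exp (- a * t) \<le> exp (- q * t)"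
      by simp_all
    have "norm (S_err t *v \<epsilon> t) \<le> norm (S_err t) * norm (\<epsilon> t) * N"
      by (rule N)
    also have "\<dots> \<le> ((B * L) * exp (- p * t)) * (G * exp ((p / 2) * t)) * N"
      using S_bound[OF that] G(2)[OF \<open>t \<ge> 0\<close>] N(1) B(1) L(1)
      by (intro mult_right_mono mult_mono) auto
    also have "\<dots> = (B * L * G * N) * (exp (- p * t) * exp ((p / 2) * t))"
      by (simp only: mult_ac)
    also have "\<dots> \<le> (B * L * G * N) * exp (- q * t)"
      unfolding ex using q(1) B(1) L(1) G(1) N(1) by (intro mult_left_mono) auto
    finally have "norm (S_err t *v \<epsilon> t) \<le> (B * L * G * N) * exp (- q * t)" .
    moreover have "C * exp (- a * t) \<le> C * exp (- q * t)"
      using q(2) C(1) by (intro mult_left_mono) auto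
    ultimately show ?thesis
      unfolding \<epsilon>\<^sub>T_err[OF \<open>t \<ge> 0\<close>] distrib_right
      using C(2)[OF \<open>t \<ge> 0\<close>] norm_triangle_ineq[of "S_err t *v \<epsilon> t" "\<rho>\<^sub>\<Delta>_err t"] by linarith
  qed
  moreover have "B * L * G * N + C > 0" "q > 0"
    using B(1,2) L(1) G(1) N(1) C(1) a_pos by (auto simp: q_def intro!: add_pos_pos)
  ultimately have "exponentially_convergent (\<lambda>t. \<epsilon>\<^sub>T t - \<epsilon>\<^sub>T_hat t)"
    unfolding exponentially_convergent_def eventually_at_top_linorder by blast
  with S_conv show ?thesis ..
qed

end
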